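(* As linear maps from $\mathbb{C}[\xi,z]$ to $\mathbb{C}[\xi,z]$, one has $$\Phi=\mathcal{R}\circ\mathcal{L}^{-1},\qquad \Phi_{t=-1}=\mathcal{L}\circ\mathcal{R}^{-1}.$$
   Context: Let $\xi=(\xi_1,\dots,\xi_n)$ and $z=(z_1,\dots,z_n)$ be $2n$ commuting free variables, $\partial_i=\partial/\partial z_i$, $\delta_i=\partial/\partial\xi_i$, $\Lambda:=\sum_{i=1}^n\delta_i\partial_i$ (a locally nilpotent operator on $\mathbb{C}[\xi,z]$), $\Phi_t:=e^{t\Lambda}=\sum_{m\ge0}\frac{t^m\Lambda^m}{m!}$ for $t\in\mathbb{C}$, and $\Phi:=\Phi_{t=1}$. Let $\mathcal{D}[z]$ be the Weyl algebra of polynomial differential operators of $\mathbb{C}[z]$. Every $\phi\in\mathcal{D}[z]$ can be written uniquely as finite sums $\phi=\sum_{\alpha\in\mathbb{N}^n}a_\alpha(z)\partial^\alpha=\sum_{\beta\in\mathbb{N}^n}\partial^\beta b_\beta(z)$, where $a_\alpha(z),b_\beta(z)\in\mathbb{C}[z]$ stand for multiplication operators and products are compositions of operators. The right total symbol of $\phi$ is $\mathcal{R}(\phi):=\sum_\alpha a_\alpha(z)\xi^\alpha\in\mathbb{C}[\xi,z]$ and the left total symbol is $\mathcal{L}(\phi):=\sum_\beta b_\beta(z)\xi^\beta\in\mathbb{C}[\xi,z]$. Both $\mathcal{R},\mathcal{L}:\mathcal{D}[z]\to\mathbb{C}[\xi,z]$ are isomorphisms of vector spaces. *)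

theory Defs
  imports Complex_Main "HOL-Library.Poly_Mapping"
begin

text \<open>
  Polynomials over \<open>\<complex>\<close> in a family of commuting variables indexed by a type: finitely supported
  functions from exponents to coefficients, with the convolution product of
  \<^theory>\<open>HOL-Library.Poly_Mapping\<close>. For \<open>'n :: finite\<close> with \<open>n = CARD('n)\<close>, the ring \<open>\<complex>[z]\<close> is
  \<open>'n pol\<close>, and \<open>\<complex>[\<xi>,z]\<close> is \<open>('n + 'n) pol\<close> with \<open>\<xi>\<^sub>i\<close> the variable \<open>Inl i\<close> and \<open>z\<^sub>i\<close> the
  variable \<open>Inr i\<close>.
\<close>

type_synonym 'v expo = "'v \<Rightarrow>\<^sub>0 nat"
type_synonym 'v pol = "'v expo \<Rightarrow>\<^sub>0 complex"

abbreviation const :: "complex \<Rightarrow> 'v pol" where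
  "const c \<equiv> Poly_Mapping.single 0 c"

text \<open>
  If the variable \<open>v\<close> does not occur in the monomial \<open>m\<close>, then the subtraction is truncated, but the
  coefficient is \<open>0\<close>.
\<close>

definition mderiv :: "'v \<Rightarrow> 'v pol \<Rightarrow> 'v pol" where
  "mderiv v p = (\<Sum>m\<in>Poly_Mapping.keys p.
     Poly_Mapping.single (m - Poly_Mapping.single v 1)
       (of_nat (Poly_Mapping.lookup m v) * Poly_Mapping.lookup p m))"

lemma lookup_mderiv:
  "Poly_Mapping.lookup (mderiv v p) m =
     of_nat (Poly_Mapping.lookup m v + 1) * Poly_Mapping.lookup p (m + Poly_Mapping.single v 1)"
proof -
  let ?e = "Poly_Mapping.single v (1::nat)"
  have step: "Poly_Mapping.lookup (Poly_Mapping.single (k - ?e)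
        (of_nat (Poly_Mapping.lookup k v) * Poly_Mapping.lookup p k)) m =
      (if k = m + ?e then of_nat (Poly_Mapping.lookup m v + 1) * Poly_Mapping.lookup p k else 0)"
    (is "?l = ?r") for k
  proof (cases "Poly_Mapping.lookup k v = 0")
    case True
    then have "k \<noteq> m + ?e" by (auto simp: lookup_add)
    with True show ?thesis by simp
  next
    case False
    then have "k - ?e + ?e = k"
      by (intro poly_mapping_eqI) (auto simp: lookup_add lookup_minus lookup_single when_def)
    then have "k - ?e = m \<longleftrightarrow> k = m + ?e" by auto
    then show ?thesis by (auto simp: lookup_single when_def lookup_add)
  qed
  show ?thesis
    unfolding mderiv_def lookup_sum step
    by (simp add: in_keys_iff)
qed

lemma mderiv_commute: "mderiv v (mderiv w p) = mderiv w (mderiv v p)"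
  by (intro poly_mapping_eqI)
     (auto simp: lookup_mderiv lookup_add lookup_single when_def algebra_simps)

lemma mderiv_funpow_commute:
  "(mderiv v ^^ k) ((mderiv w ^^ l) p) = (mderiv w ^^ l) ((mderiv v ^^ k) p)"
proof -
  have 1: "mderiv v ((mderiv w ^^ l) q) = (mderiv w ^^ l) (mderiv v q)" for q
    by (induction l) (simp, metis comp_apply funpow.simps(2) mderiv_commute)
  show ?thesis by (induction k) (simp_all add: 1)
qed

text \<open>
  The operator \<open>\<partial>\<^sup>\<alpha>\<close>. The order in which the factors \<open>\<partial>\<^sub>i\<close> to the power \<open>\<alpha>\<^sub>i\<close> are composed is
  immaterial, since they commute.
\<close>

definition mderiv_pow :: "('n::finite) expo \<Rightarrow> 'n pol \<Rightarrow> 'n pol" where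
  "mderiv_pow \<alpha> f = Finite_Set.fold (\<lambda>i. mderiv i ^^ Poly_Mapping.lookup \<alpha> i) f UNIV"

lemma comp_fun_commute_mderiv_pow: "comp_fun_commute (\<lambda>i. mderiv i ^^ Poly_Mapping.lookup \<alpha> i)"
  by unfold_locales (simp add: fun_eq_iff mderiv_funpow_commute)

inductive_set weyl_algebra :: "(('n::finite) pol \<Rightarrow> 'n pol) set" where
  mult: "(\<lambda>f. a * f) \<in> weyl_algebra"
| deriv: "mderiv i \<in> weyl_algebra"
| add: "\<phi> \<in> weyl_algebra \<Longrightarrow> \<psi> \<in> weyl_algebra \<Longrightarrow> (\<lambda>f. \<phi> f + \<psi> f) \<in> weyl_algebra"
| comp: "\<phi> \<in> weyl_algebra \<Longrightarrow> \<psi> \<in> weyl_algebra \<Longrightarrow> \<phi> \<circ> \<psi> \<in> weyl_algebra"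

definition rename_expo :: "('v \<Rightarrow> 'w) \<Rightarrow> 'v expo \<Rightarrow> 'w expo" where
  "rename_expo h m =
     (\<Sum>v\<in>Poly_Mapping.keys m. Poly_Mapping.single (h v) (Poly_Mapping.lookup m v))"

definition rename_pol :: "('v \<Rightarrow> 'w) \<Rightarrow> 'v pol \<Rightarrow> 'w pol" where
  "rename_pol h p =
     (\<Sum>m\<in>Poly_Mapping.keys p. Poly_Mapping.single (rename_expo h m) (Poly_Mapping.lookup p m))"

text \<open>
  A finitely supported family of coefficients \<open>a\<^sub>\<alpha>(z)\<close> gives the operators
  \<open>\<Sum>\<^sub>\<alpha> a\<^sub>\<alpha>(z) \<partial>\<^sup>\<alpha>\<close> and \<open>\<Sum>\<^sub>\<alpha> \<partial>\<^sup>\<alpha> a\<^sub>\<alpha>(z)\<close>, and the polynomial \<open>\<Sum>\<^sub>\<alpha> a\<^sub>\<alpha>(z) \<xi>\<^sup>\<alpha>\<close>.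
\<close>

definition right_op :: "(('n::finite) expo \<Rightarrow>\<^sub>0 'n pol) \<Rightarrow> 'n pol \<Rightarrow> 'n pol" where
  "right_op a f = (\<Sum>\<alpha>\<in>Poly_Mapping.keys a. Poly_Mapping.lookup a \<alpha> * mderiv_pow \<alpha> f)"

definition left_op :: "(('n::finite) expo \<Rightarrow>\<^sub>0 'n pol) \<Rightarrow> 'n pol \<Rightarrow> 'n pol" where
  "left_op b f = (\<Sum>\<beta>\<in>Poly_Mapping.keys b. mderiv_pow \<beta> (Poly_Mapping.lookup b \<beta> * f))"

definition symbol_pol :: "(('n::finite) expo \<Rightarrow>\<^sub>0 'n pol) \<Rightarrow> ('n + 'n) pol" where
  "symbol_pol a = (\<Sum>\<alpha>\<in>Poly_Mapping.keys a.
     rename_pol Inr (Poly_Mapping.lookup a \<alpha>) * Poly_Mapping.single (rename_expo Inl \<alpha>) 1)"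

text \<open>The total symbols; they are meaningful on \<open>weyl_algebra\<close> only.\<close>

definition right_symbol :: "(('n::finite) pol \<Rightarrow> 'n pol) \<Rightarrow> ('n + 'n) pol" where
  "right_symbol \<phi> = symbol_pol (THE a. \<phi> = right_op a)"

definition left_symbol :: "(('n::finite) pol \<Rightarrow> 'n pol) \<Rightarrow> ('n + 'n) pol" where
  "left_symbol \<phi> = symbol_pol (THE b. \<phi> = left_op b)"

definition Lambda :: "(('n::finite) + 'n) pol \<Rightarrow> ('n + 'n) pol" where
  "Lambda p = (\<Sum>i\<in>UNIV. mderiv (Inl i) (mderiv (Inr i) p))"

text \<open>
  \<^const>\<open>Sum_any\<close> sums over the support, which is finite here because \<^const>\<open>Lambda\<close> is locally nilpotent.
\<close>

definition Phi :: "complex \<Rightarrow> (('n::finite) + 'n) pol \<Rightarrow> ('n + 'n) pol" where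
  "Phi t p = Sum_any (\<lambda>m. const (t ^ m / fact m) * (Lambda ^^ m) p)"

definition xi_degree :: "(('n::finite) + 'n) expo \<Rightarrow> nat" where
  "xi_degree m = (\<Sum>i\<in>UNIV. Poly_Mapping.lookup m (Inl i))"

lemma lookup_Lambda_eq_0:
  fixes p :: "(('n::finite) + 'n) pol"
  assumes "\<And>m. xi_degree m \<ge> Suc d \<Longrightarrow> Poly_Mapping.lookup p m = 0" and "xi_degree m \<ge> d"
  shows "Poly_Mapping.lookup (Lambda p) m = 0"
proof -
  have "xi_degree (m + Poly_Mapping.single (Inl i) 1 + Poly_Mapping.single (Inr i) 1)
      = Suc (xi_degree m)" for i
    by (simp add: xi_degree_def lookup_add lookup_single when_def sum.distrib)
  then have "Poly_Mapping.lookup p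
      (m + Poly_Mapping.single (Inl i) 1 + Poly_Mapping.single (Inr i) 1) = 0" for i
    using assms by simp
  then show ?thesis
    by (simp add: Lambda_def lookup_sum lookup_mderiv)
qed

lemma Lambda_locally_nilpotent:
  fixes p :: "(('n::finite) + 'n) pol"
  shows "\<exists>k. \<forall>m\<ge>k. (Lambda ^^ m) p = 0"
proof -
  have ex: "(Lambda ^^ d) q = 0"
    if "\<And>m. xi_degree m \<ge> d \<Longrightarrow> Poly_Mapping.lookup q m = 0"
    for d and q :: "('n + 'n) pol"
    using that
  proof (induction d arbitrary: q)
    case 0
    then show ?case by (simp add: poly_mapping_eqI)
  next
    case (Suc d)
    have "(Lambda ^^ d) (Lambda q) = 0"
      by (rule Suc.IH) (rule lookup_Lambda_eq_0[OF Suc.prems])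
    then show ?case by (simp add: funpow_swap1)
  qed
  define k where "k = Suc (Max (insert 0 (xi_degree ` Poly_Mapping.keys p)))"
  have k: "xi_degree m < k" if "m \<in> Poly_Mapping.keys p" for m
    unfolding k_def using that by (simp add: le_imp_less_Suc)
  have "(Lambda ^^ m) p = 0" if "m \<ge> k" for m
    using k that by (intro ex) (meson in_keys_iff le_trans not_le)
  then show ?thesis by blast
qed

lemma finite_support_Phi: "finite {m. const (t ^ m / fact m) * (Lambda ^^ m) p \<noteq> 0}"
proof -
  obtain k where "\<And>m. m \<ge> k \<Longrightarrow> (Lambda ^^ m) p = 0"
    using Lambda_locally_nilpotent by blast
  then have "{m. const (t ^ m / fact m) * (Lambda ^^ m) p \<noteq> 0} \<subseteq> {..<k}"
    by (auto simp: not_le[symmetric])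
  then show ?thesis by (rule finite_subset) simp
qed

end

theory Submission
  imports Defs
begin

text \<open>
  Write \<open>R\<^sub>p\<close> for the operator with right symbol \<open>p\<close> (each \<open>\<xi>\<^sup>\<alpha> z\<^sup>\<gamma>\<close> becomes \<open>z\<^sup>\<gamma> \<partial>\<^sup>\<alpha>\<close>) and \<open>L\<^sub>p\<close> for the
  operator with left symbol \<open>p\<close> (each \<open>\<xi>\<^sup>\<alpha> z\<^sup>\<gamma>\<close> becomes \<open>\<partial>\<^sup>\<alpha> z\<^sup>\<gamma>\<close>). The heart of the matter is the
  identity \<open>L\<^sub>p = R\<^sub>q\<close> with \<open>q = \<Phi> p\<close> (\<open>left_quant_eq_right_quant_Phi\<close>). It is proved by building \<open>p\<close>
  from constants by addition and multiplication by single variables, because both sides react to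
  such a multiplication in the same way.

  On the operator side, multiplying \<open>p\<close> by \<open>\<xi>\<^sub>i\<close> composes \<open>L\<^sub>p\<close> with \<open>\<partial>\<^sub>i\<close> on the left, and multiplying
  by \<open>z\<^sub>i\<close> composes it with \<open>z\<^sub>i\<close> on the right. For operators written as \<open>R\<^sub>q\<close> these two compositions
  act on \<open>q\<close> as \<open>\<xi>\<^sub>i + \<partial>\<^sub>i\<close> and \<open>z\<^sub>i + \<delta>\<^sub>i\<close> (\<open>mderiv_right_quant\<close>, \<open>right_quant_var_mult\<close>): these are the
  canonical commutation relations. On the polynomial side, \<open>[\<Lambda>, \<xi>\<^sub>i] = \<partial>\<^sub>i\<close> and \<open>[\<Lambda>, z\<^sub>i] = \<delta>\<^sub>i\<close> commute with
  \<open>\<Lambda>\<close>, hence conjugation by \<open>e\<^bsup>t\<Lambda>\<^esup>\<close> turns \<open>\<xi>\<^sub>i\<close> and \<open>z\<^sub>i\<close> into \<open>\<xi>\<^sub>i + t \<partial>\<^sub>i\<close> and \<open>z\<^sub>i + t \<delta>\<^sub>i\<close>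
  (\<open>Phi_var_mult\<close>). At \<open>t = 1\<close> the two descriptions agree.

  What remains is that \<open>R\<close> and \<open>L\<close> are bijections onto the Weyl algebra. For \<open>R\<close>, injectivity follows
  from \<open>[R\<^sub>p, z\<^sub>i] = R\<^sub>q\<close> with \<open>q = \<delta>\<^sub>i p\<close>, which lowers the degree in \<open>\<xi>\<close> until \<open>p\<close> can be read off from
  \<open>R\<^sub>p 1\<close>, and surjectivity from the commutation relations again. The statements for \<open>L\<close> are
  transported along \<open>\<Phi>\<close>, whose inverse is \<open>e\<^bsup>-\<Lambda>\<^esup>\<close> (\<open>Phi_uminus_Phi\<close>).
\<close>

section \<open>Polynomials as sums of monomials\<close>

lemma poly_mapping_add_induct [case_names single add]:
  fixes p :: "'k \<Rightarrow>\<^sub>0 'b::comm_monoid_add"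
  assumes single: "\<And>k c. P (Poly_Mapping.single k c)"
    and add: "\<And>p q. P p \<Longrightarrow> P q \<Longrightarrow> P (p + q)"
  shows "P p"
proof (induction p rule: update_induct)
  case const
  show ?case using single[of undefined 0] by simp
next
  case (update f a b)
  have "Poly_Mapping.update a b f = Poly_Mapping.single a b + f"
    using update(1)
    by (intro poly_mapping_eqI)
       (auto simp: lookup_update lookup_add lookup_single when_def in_keys_iff)
  then show ?case using add single update(3) by simp
qed

lemma sum_keys_single:
  assumes "f k 0 = 0"
  shows "(\<Sum>k'\<in>Poly_Mapping.keys (Poly_Mapping.single k c).
      f k' (Poly_Mapping.lookup (Poly_Mapping.single k c) k'))
    = f k c"
  using assms by simp

definition var :: "'v \<Rightarrow> 'v pol" where
  "var v = Poly_Mapping.single (Poly_Mapping.single v 1) 1"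

lemma var_mult_single:
  "var v * Poly_Mapping.single m c = Poly_Mapping.single (m + Poly_Mapping.single v 1) c"
  by (simp add: var_def mult_single add.commute)

lemma var_mult_single_mult:
  "var v * (Poly_Mapping.single m c * p) = Poly_Mapping.single (m + Poly_Mapping.single v 1) c * p"
  by (simp only: var_mult_single flip: mult.assoc)

text \<open>
  The form of induction on polynomials that fits commutation relations: it only asks how a property
  behaves under multiplication by one variable.
\<close>

lemma pol_induct [case_names const add var]:
  fixes p :: "'v pol"
  assumes const: "\<And>c. P (const c)"
    and add: "\<And>p q. P p \<Longrightarrow> P q \<Longrightarrow> P (p + q)"
    and var: "\<And>v p. P p \<Longrightarrow> P (var v * p)"
  shows "P p"
proof (induction p rule: poly_mapping_add_induct)
  case (single m c)
  have "P (Poly_Mapping.single m' c) \<Longrightarrow> P (Poly_Mapping.single (m' + m) c)" for m'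
  proof (induction m arbitrary: m' rule: poly_mapping_add_induct)
    case (single v k)
    then show ?case
    proof (induction k)
      case 0
      then show ?case by simp
    next
      case (Suc k)
      have "m' + Poly_Mapping.single v (Suc k) = m' + Poly_Mapping.single v k + Poly_Mapping.single v 1"
        by (simp add: add.assoc flip: single_add)
      then show ?case
        using var[OF Suc.IH[OF Suc.prems], of v] by (simp only: var_mult_single)
    qed
  next
    case (add m1 m2)
    then show ?case by (simp flip: add.assoc)
  qed
  from this[OF const] show ?case by simp
next
  case (add p q)
  then show ?case by (rule assms)
qed

lemma lookup_const_mult:
  "Poly_Mapping.lookup (const c * p) m = c * Poly_Mapping.lookup p m"
  by (simp add: Poly_Mapping.map.rep_eq when_def flip: mult_map_scale_conv_mult)

section \<open>Derivatives\<close>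

lemma mderiv_add: "mderiv v (p + q) = mderiv v p + mderiv v q"
  by (intro poly_mapping_eqI) (simp add: lookup_mderiv lookup_add algebra_simps)

lemma mderiv_0 [simp]: "mderiv v 0 = 0"
  by (simp add: mderiv_def)

lemma mderiv_const_mult: "mderiv v (const c * p) = const c * mderiv v p"
  by (intro poly_mapping_eqI) (simp add: lookup_mderiv lookup_const_mult)

lemma mderiv_single:
  "mderiv v (Poly_Mapping.single m c) =
     Poly_Mapping.single (m - Poly_Mapping.single v 1) (of_nat (Poly_Mapping.lookup m v) * c)"
  unfolding mderiv_def by (rule sum_keys_single) simp

lemma mderiv_const [simp]: "mderiv v (const c) = 0"
  by (simp add: mderiv_single)

lemma mderiv_var_mult:
  "mderiv v (var w * p) = (if v = w then p else 0) + var w * mderiv v p"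
proof (induction p rule: poly_mapping_add_induct)
  case (single m c)
  show ?case
  proof (cases "v = w")
    case True
    have "m - Poly_Mapping.single v 1 + Poly_Mapping.single v 1 = m" if "Poly_Mapping.lookup m v \<noteq> 0"
      using that by (intro poly_mapping_eqI) (auto simp: lookup_add lookup_minus lookup_single when_def)
    with True show ?thesis
      by (cases "Poly_Mapping.lookup m v = 0")
         (simp_all add: var_mult_single mderiv_single lookup_add algebra_simps flip: single_add)
  next
    case False
    then have "m + Poly_Mapping.single w 1 - Poly_Mapping.single v 1
        = m - Poly_Mapping.single v 1 + Poly_Mapping.single w 1"
      by (intro poly_mapping_eqI) (auto simp: lookup_add lookup_minus lookup_single when_def)
    with False show ?thesis
      by (simp add: var_mult_single mderiv_single lookup_add lookup_single)
  qed
next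
  case (add p q)
  then show ?case by (simp add: mderiv_add algebra_simps)
qed

lemma mderiv_pow_add: "mderiv_pow \<alpha> (f + g) = mderiv_pow \<alpha> f + mderiv_pow \<alpha> g"
proof -
  interpret comp_fun_commute "\<lambda>i. mderiv i ^^ Poly_Mapping.lookup \<alpha> i"
    by (rule comp_fun_commute_mderiv_pow)
  have funpow: "(mderiv v ^^ k) (p + q) = (mderiv v ^^ k) p + (mderiv v ^^ k) q"
    for v k and p q :: "'a pol"
    by (induction k) (simp_all add: mderiv_add)
  have "Finite_Set.fold (\<lambda>i. mderiv i ^^ Poly_Mapping.lookup \<alpha> i) (f + g) A =
      Finite_Set.fold (\<lambda>i. mderiv i ^^ Poly_Mapping.lookup \<alpha> i) f A +
      Finite_Set.fold (\<lambda>i. mderiv i ^^ Poly_Mapping.lookup \<alpha> i) g A" if "finite A" for A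
    using that by induction (simp_all add: funpow)
  then show ?thesis by (simp add: mderiv_pow_def)
qed

lemma mderiv_pow_zero [simp]: "mderiv_pow \<alpha> 0 = 0"
  using mderiv_pow_add[of \<alpha> 0 0] by simp

lemma mderiv_pow_0 [simp]: "mderiv_pow 0 f = f"
proof -
  interpret comp_fun_commute "\<lambda>i::'a. id :: 'a pol \<Rightarrow> 'a pol"
    by unfold_locales auto
  have "Finite_Set.fold (\<lambda>i::'a. id) f A = f" if "finite A" for A
    using that
  proof induction
    case (insert i A)
    show ?case by (rule trans[OF fold_insert[OF insert(1,2)]]) (simp only: insert(3) id_apply)
  qed simp
  then show ?thesis by (simp add: mderiv_pow_def)
qed

lemma mderiv_pow_commute: "mderiv_pow \<alpha> (mderiv i f) = mderiv i (mderiv_pow \<alpha> f)"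
proof -
  interpret comp_fun_commute "\<lambda>i. mderiv i ^^ Poly_Mapping.lookup \<alpha> i"
    by (rule comp_fun_commute_mderiv_pow)
  have "Finite_Set.fold (\<lambda>i. mderiv i ^^ Poly_Mapping.lookup \<alpha> i) (mderiv i f) A =
      mderiv i (Finite_Set.fold (\<lambda>i. mderiv i ^^ Poly_Mapping.lookup \<alpha> i) f A)" if "finite A" for A
    using that
    by induction (simp_all add: mderiv_funpow_commute[where k = 1, simplified])
  then show ?thesis by (simp add: mderiv_pow_def)
qed

text \<open>
  A product over all indices is changed by a single factor; the induction over the index set has to
  distinguish whether that factor has already been met.
\<close>

lemma mderiv_pow_plus_single:
  "mderiv_pow (\<alpha> + Poly_Mapping.single i 1) f = mderiv i (mderiv_pow \<alpha> f)"
proof -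
  let ?\<alpha>' = "\<alpha> + Poly_Mapping.single i 1"
  let ?g = "\<lambda>i. mderiv i ^^ Poly_Mapping.lookup \<alpha> i"
    and ?g' = "\<lambda>j. mderiv j ^^ Poly_Mapping.lookup ?\<alpha>' j"
  interpret comp_fun_commute ?g by (rule comp_fun_commute_mderiv_pow)
  interpret g': comp_fun_commute ?g' by (rule comp_fun_commute_mderiv_pow)
  have "Finite_Set.fold ?g' f A =
      (if i \<in> A then mderiv i (Finite_Set.fold ?g f A) else Finite_Set.fold ?g f A)"
    if "finite A" for A
    using that
  proof induction
    case empty
    show ?case by simp
  next
    case (insert j A)
    have "?g' j = (if j = i then mderiv i \<circ> ?g j else ?g j)"
      by (simp add: lookup_add lookup_single)
    then show ?case
      using insert by (auto simp: g'.fold_insert mderiv_funpow_commute[where k = 1, simplified]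
          simp del: One_nat_def)
  qed
  then show ?thesis by (simp add: mderiv_pow_def)
qed

lemma mderiv_pow_1:
  assumes "\<alpha> \<noteq> 0"
  shows "mderiv_pow \<alpha> 1 = 0"
proof -
  obtain i where i: "Poly_Mapping.lookup \<alpha> i \<noteq> 0"
    using assms by (metis lookup_zero poly_mapping_eqI)
  let ?e = "Poly_Mapping.single i (1::nat)"
  have "\<alpha> - ?e + ?e = \<alpha>"
    using i by (intro poly_mapping_eqI) (auto simp: lookup_add lookup_minus lookup_single when_def)
  then have "mderiv_pow \<alpha> 1 = mderiv_pow (\<alpha> - ?e) (mderiv i (const 1))"
    using mderiv_pow_plus_single[of "\<alpha> - ?e" i 1] by (simp only: mderiv_pow_commute single_one)
  also have "\<dots> = 0"
    by (simp only: mderiv_const mderiv_pow_zero)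
  finally show ?thesis .
qed

section \<open>The exponential of \<open>\<Lambda>\<close>\<close>

lemma Lambda_add: "Lambda (p + q) = Lambda p + Lambda q"
  by (simp add: Lambda_def mderiv_add sum.distrib)

lemma Lambda_const_mult: "Lambda (const c * p) = const c * Lambda p"
  by (simp add: Lambda_def mderiv_const_mult sum_distrib_left)

lemma Lambda_0 [simp]: "Lambda 0 = 0"
  using Lambda_const_mult[of 0 0] by simp

lemma Lambda_const [simp]: "Lambda (const c) = 0"
  by (simp add: Lambda_def mderiv_def)

lemma Lambda_mderiv: "Lambda (mderiv v p) = mderiv v (Lambda p)"
proof -
  have sum: "mderiv v (\<Sum>i\<in>A. g i) = (\<Sum>i\<in>A. mderiv v (g i))" if "finite A"
    for A and g :: "'a \<Rightarrow> ('a + 'a) pol"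
    using that by induction (simp_all add: mderiv_add)
  show ?thesis
    by (simp add: Lambda_def sum) (metis mderiv_commute)
qed

text \<open>
  The conjugate variable: \<open>[\<Lambda>, v]\<close> is the derivation with respect to \<open>dual v\<close>, so that the relations
  for \<open>\<xi>\<^sub>i\<close> and for \<open>z\<^sub>i\<close> become one.
\<close>

fun dual :: "'n + 'n \<Rightarrow> 'n + 'n" where
  "dual (Inl i) = Inr i"
| "dual (Inr i) = Inl i"

lemma Lambda_var_mult: "Lambda (var v * p) = var v * Lambda p + mderiv (dual v) p"
proof -
  have "Lambda (var v * p) =
      (\<Sum>i\<in>UNIV. var v * mderiv (Inl i) (mderiv (Inr i) p) +
        (if dual v = Inl i \<or> dual v = Inr i then mderiv (dual v) p else 0))"
    unfolding Lambda_def
    by (rule sum.cong, simp, cases v) (auto simp: mderiv_var_mult mderiv_add add_ac)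
  also have "\<dots> = var v * Lambda p + mderiv (dual v) p"
    by (cases v) (simp_all add: Lambda_def sum.distrib sum_distrib_left)
  finally show ?thesis .
qed

lemma Lambda_pow_add: "(Lambda ^^ m) (p + q) = (Lambda ^^ m) p + (Lambda ^^ m) q"
  by (induction m) (simp_all add: Lambda_add)

lemma Lambda_pow_const_mult: "(Lambda ^^ m) (const c * p) = const c * (Lambda ^^ m) p"
  by (induction m) (simp_all add: Lambda_const_mult)

lemma Lambda_pow_0 [simp]: "(Lambda ^^ m) 0 = 0"
  by (induction m) simp_all

lemma Lambda_pow_mderiv: "(Lambda ^^ m) (mderiv v p) = mderiv v ((Lambda ^^ m) p)"
  by (induction m) (simp_all add: Lambda_mderiv)

text \<open>
  The commutator \<open>[\<Lambda>, v]\<close> commutes with \<open>\<Lambda>\<close>, hence \<open>[\<Lambda>\<^bsup>m+1\<^esup>, v] = (m + 1) \<Lambda>\<^sup>m [\<Lambda>, v]\<close>, as for the derivative of a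
  power.
\<close>

lemma Lambda_pow_var_mult:
  "(Lambda ^^ Suc m) (var v * p) =
     var v * (Lambda ^^ Suc m) p + const (of_nat (Suc m)) * (Lambda ^^ m) (mderiv (dual v) p)"
proof (induction m)
  case 0
  show ?case by (simp add: Lambda_var_mult)
next
  case (Suc m)
  have const: "const (of_nat (Suc (Suc m)) :: complex) = 1 + const (of_nat (Suc m))"
    by (simp only: of_nat_Suc[of "Suc m"] single_add single_one)
  let ?A = "(Lambda ^^ Suc m) p" and ?B = "(Lambda ^^ m) (mderiv (dual v) p)"
  have "(Lambda ^^ Suc (Suc m)) (var v * p) = Lambda (var v * ?A + const (of_nat (Suc m)) * ?B)"
    using Suc by simp
  also have "\<dots> = var v * Lambda ?A + mderiv (dual v) ?A + const (of_nat (Suc m)) * Lambda ?B"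
    by (simp only: Lambda_add Lambda_var_mult Lambda_const_mult)
  also have "mderiv (dual v) ?A = Lambda ?B"
    by (simp add: Lambda_pow_mderiv Lambda_mderiv)
  also have "var v * Lambda ?A + Lambda ?B + const (of_nat (Suc m)) * Lambda ?B
      = var v * Lambda ?A + const (of_nat (Suc (Suc m))) * Lambda ?B"
    by (simp only: const distrib_right mult_1_left add.assoc)
  finally show ?case by (simp only: funpow.simps o_apply)
qed

lemma Phi_eq_sum:
  assumes "\<And>m. m \<ge> N \<Longrightarrow> (Lambda ^^ m) p = 0"
  shows "Phi t p = (\<Sum>m<N. const (t ^ m / fact m) * (Lambda ^^ m) p)"
  unfolding Phi_def
  by (rule Sum_any.expand_superset) (auto simp: assms not_le[symmetric])

lemma Phi_add: "Phi t (p + q) = Phi t p + Phi t q"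
  unfolding Phi_def Lambda_pow_add distrib_left
  by (rule Sum_any.distrib[OF finite_support_Phi finite_support_Phi])

lemma Phi_const_mult: "Phi t (const c * p) = const c * Phi t p"
proof -
  have "Phi t (const c * p) = Sum_any (\<lambda>m. const c * (const (t ^ m / fact m) * (Lambda ^^ m) p))"
    by (simp add: Phi_def Lambda_pow_const_mult mult.left_commute)
  also have "\<dots> = const c * Phi t p"
    unfolding Phi_def by (rule Sum_any_right_distrib[OF finite_support_Phi, symmetric])
  finally show ?thesis .
qed

lemma Phi_const [simp]: "Phi t (const c) = const c"
proof -
  have "(Lambda ^^ m) (const c) = 0" if "m \<ge> 1" for m
    using that by (cases m) (simp_all add: funpow_Suc_right del: funpow.simps)
  then show ?thesis
    by (subst Phi_eq_sum[where N = 1]) simp_all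
qed

lemma mderiv_Phi: "mderiv v (Phi t p) = Phi t (mderiv v p)"
proof -
  obtain N where N: "\<And>m. m \<ge> N \<Longrightarrow> (Lambda ^^ m) p = 0"
    using Lambda_locally_nilpotent by blast
  then have N': "\<And>m. m \<ge> N \<Longrightarrow> (Lambda ^^ m) (mderiv v p) = 0"
    by (simp add: Lambda_pow_mderiv)
  have sum: "mderiv v (\<Sum>m<N. g m) = (\<Sum>m<N. mderiv v (g m))" for N :: nat and g
    by (induction N) (simp_all add: mderiv_add)
  show ?thesis
    by (simp add: Phi_eq_sum[OF N] Phi_eq_sum[OF N'] sum mderiv_const_mult Lambda_pow_mderiv)
qed

text \<open>
  Conjugating the multiplication by \<open>v\<close> with \<open>e\<^bsup>t\<Lambda>\<^esup>\<close> adds \<open>t [\<Lambda>, v]\<close>: the series stops after the first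
  commutator. In the computation, the factor \<open>m + 1\<close> from \<open>Lambda_pow_var_mult\<close> cancels against
  \<open>1 / (m + 1)!\<close>, which leaves \<open>t\<close> times the exponential series shifted by one.
\<close>

lemma Phi_var_mult:
  "Phi t (var v * p) = var v * Phi t p + const t * Phi t (mderiv (dual v) p)"
proof -
  let ?q = "mderiv (dual v) p"
  obtain N where N: "\<And>m. m \<ge> N \<Longrightarrow> (Lambda ^^ m) p = 0"
    using Lambda_locally_nilpotent by blast
  then have Nq: "\<And>m. m \<ge> N \<Longrightarrow> (Lambda ^^ m) ?q = 0"
    by (simp add: Lambda_pow_mderiv)
  have Np: "\<And>m. m \<ge> Suc N \<Longrightarrow> (Lambda ^^ m) p = 0"
    using N by simp
  have Nv: "(Lambda ^^ m) (var v * p) = 0" if m: "m \<ge> Suc N" for m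
  proof -
    obtain k where "m = Suc k" "k \<ge> N" using m by (cases m) auto
    then show ?thesis
      using N[of "Suc k"] Nq[of k] by (simp only: Lambda_pow_var_mult) simp
  qed
  have shift: "const (t ^ Suc m / fact (Suc m)) * (Lambda ^^ Suc m) (var v * p) =
      var v * (const (t ^ Suc m / fact (Suc m)) * (Lambda ^^ Suc m) p)
      + const t * (const (t ^ m / fact m) * (Lambda ^^ m) ?q)" for m
  proof -
    have "t ^ Suc m / fact (Suc m) * of_nat (Suc m) = t * (t ^ m / fact m)"
      by (simp add: field_simps del: of_nat_Suc)
    then have "const (t ^ Suc m / fact (Suc m)) * const (of_nat (Suc m)) =
        (const t * const (t ^ m / fact m) :: ('a + 'a) pol)"
      by (simp only: mult_single)
    then show ?thesis
      unfolding Lambda_pow_var_mult distrib_left mult.assoc[symmetric]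
      by (simp only: mult.commute mult.left_commute mult.assoc)
  qed
  have "Phi t (var v * p) = (\<Sum>m<Suc N. const (t ^ m / fact m) * (Lambda ^^ m) (var v * p))"
    by (rule Phi_eq_sum[OF Nv])
  also have "\<dots> = var v * p +
      (\<Sum>m<N. const (t ^ Suc m / fact (Suc m)) * (Lambda ^^ Suc m) (var v * p))"
    by (simp only: sum.lessThan_Suc_shift) simp
  also have "\<dots> = var v * (p + (\<Sum>m<N. const (t ^ Suc m / fact (Suc m)) * (Lambda ^^ Suc m) p))
      + const t * (\<Sum>m<N. const (t ^ m / fact m) * (Lambda ^^ m) ?q)"
    by (simp only: shift sum.distrib sum_distrib_left distrib_left add.assoc)
  also have "p + (\<Sum>m<N. const (t ^ Suc m / fact (Suc m)) * (Lambda ^^ Suc m) p)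
      = (\<Sum>m<Suc N. const (t ^ m / fact m) * (Lambda ^^ m) p)"
    by (simp only: sum.lessThan_Suc_shift) simp
  also have "\<dots> = Phi t p"
    by (rule Phi_eq_sum[OF Np, symmetric])
  also have "(\<Sum>m<N. const (t ^ m / fact m) * (Lambda ^^ m) ?q) = Phi t ?q"
    by (rule Phi_eq_sum[OF Nq, symmetric])
  finally show ?thesis .
qed

text \<open>
  In the step from \<open>p\<close> to \<open>v p\<close>, the correction terms \<open>t [\<Lambda>, v]\<close> and \<open>- t [\<Lambda>, v]\<close> of the two
  exponentials cancel, since derivations commute with \<open>\<Phi>\<close>.
\<close>

lemma Phi_uminus_Phi: "Phi (- t) (Phi t p) = p"
proof (induction p rule: pol_induct)
  case (var v p)
  have "const (- t) = - (const t :: ('a + 'a) pol)"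
    by (simp add: single_uminus)
  then show ?case
    by (simp add: Phi_var_mult Phi_add Phi_const_mult mderiv_Phi var)
qed (simp_all add: Phi_add)

section \<open>Operators attached to polynomials in \<open>\<xi>\<close> and \<open>z\<close>\<close>

abbreviation xi_part :: "('n + 'n) expo \<Rightarrow> 'n expo" where
  "xi_part m \<equiv> Poly_Mapping.map_key Inl m"

abbreviation z_part :: "('n + 'n) expo \<Rightarrow> 'n expo" where
  "z_part m \<equiv> Poly_Mapping.map_key Inr m"

text \<open>
  These are \<open>right_op\<close> and \<open>left_op\<close> reindexed by polynomials in \<open>\<xi>\<close> and \<open>z\<close> instead of families of
  coefficients, so that multiplication by a variable makes sense on the argument. They invert the
  right and the left total symbol.
\<close>

definition right_quant :: "(('n::finite) + 'n) pol \<Rightarrow> 'n pol \<Rightarrow> 'n pol" where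
  "right_quant p f = (\<Sum>m\<in>Poly_Mapping.keys p.
     Poly_Mapping.single (z_part m) (Poly_Mapping.lookup p m) * mderiv_pow (xi_part m) f)"

definition left_quant :: "(('n::finite) + 'n) pol \<Rightarrow> 'n pol \<Rightarrow> 'n pol" where
  "left_quant p f = (\<Sum>m\<in>Poly_Mapping.keys p.
     mderiv_pow (xi_part m) (Poly_Mapping.single (z_part m) (Poly_Mapping.lookup p m) * f))"

lemma right_quant_add: "right_quant (p + q) f = right_quant p f + right_quant q f"
  unfolding right_quant_def
  by (rule setsum_keys_plus_distrib) (simp_all add: single_add algebra_simps)

lemma right_quant_add_right: "right_quant p (f + g) = right_quant p f + right_quant p g"
  by (simp add: right_quant_def mderiv_pow_add distrib_left sum.distrib)

lemma right_quant_0 [simp]: "right_quant 0 f = 0" "right_quant p 0 = 0"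
  by (simp_all add: right_quant_def)

lemma left_quant_add: "left_quant (p + q) f = left_quant p f + left_quant q f"
  unfolding left_quant_def
  by (rule setsum_keys_plus_distrib) (simp_all add: single_add algebra_simps mderiv_pow_add)

lemma right_quant_single:
  "right_quant (Poly_Mapping.single m c) f =
     Poly_Mapping.single (z_part m) c * mderiv_pow (xi_part m) f"
  unfolding right_quant_def by (rule sum_keys_single) simp

lemma left_quant_single:
  "left_quant (Poly_Mapping.single m c) f =
     mderiv_pow (xi_part m) (Poly_Mapping.single (z_part m) c * f)"
  unfolding left_quant_def by (rule sum_keys_single) simp

lemma lookup_xi_part [simp]: "Poly_Mapping.lookup (xi_part m) i = Poly_Mapping.lookup m (Inl i)"
  by (simp add: map_key.rep_eq[OF inj_Inl])

lemma lookup_z_part [simp]: "Poly_Mapping.lookup (z_part m) i = Poly_Mapping.lookup m (Inr i)"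
  by (simp add: map_key.rep_eq[OF inj_Inr])

lemma xi_part_plus_single:
  "xi_part (m + Poly_Mapping.single (Inl i) 1) = xi_part m + Poly_Mapping.single i 1"
  "xi_part (m + Poly_Mapping.single (Inr i) 1) = xi_part m"
  by (auto intro!: poly_mapping_eqI simp: lookup_add lookup_single when_def)

lemma z_part_plus_single:
  "z_part (m + Poly_Mapping.single (Inl i) 1) = z_part m"
  "z_part (m + Poly_Mapping.single (Inr i) 1) = z_part m + Poly_Mapping.single i 1"
  by (auto intro!: poly_mapping_eqI simp: lookup_add lookup_single when_def)

lemma right_quant_const [simp]: "right_quant (const c) f = const c * f"
  by (simp add: right_quant_single)

lemma left_quant_const [simp]: "left_quant (const c) f = const c * f"
  by (simp add: left_quant_single)

lemma right_quant_xi_mult: "right_quant (var (Inl i) * p) f = right_quant p (mderiv i f)"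
  by (induction p rule: poly_mapping_add_induct)
     (simp_all add: var_mult_single right_quant_single xi_part_plus_single z_part_plus_single
        mderiv_pow_plus_single mderiv_pow_commute distrib_left right_quant_add del: One_nat_def)

lemma right_quant_z_mult: "right_quant (var (Inr i) * p) f = var i * right_quant p f"
  by (induction p rule: poly_mapping_add_induct)
     (simp_all add: var_mult_single right_quant_single xi_part_plus_single z_part_plus_single
        var_mult_single_mult distrib_left right_quant_add del: One_nat_def)

lemma left_quant_xi_mult: "left_quant (var (Inl i) * p) f = mderiv i (left_quant p f)"
  by (induction p rule: poly_mapping_add_induct)
     (simp_all add: var_mult_single left_quant_single xi_part_plus_single z_part_plus_single
        mderiv_pow_plus_single distrib_left left_quant_add mderiv_add del: One_nat_def)

lemma left_quant_z_mult: "left_quant (var (Inr i) * p) f = left_quant p (var i * f)"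
proof (induction p rule: poly_mapping_add_induct)
  case (single m c)
  have "Poly_Mapping.single (z_part m + Poly_Mapping.single i 1) c * f
      = Poly_Mapping.single (z_part m) c * (var i * f)"
    by (simp only: var_mult_single_mult[symmetric] mult.left_commute)
  then show ?case
    by (simp add: var_mult_single left_quant_single xi_part_plus_single z_part_plus_single
        del: One_nat_def)
qed (simp add: distrib_left left_quant_add)

text \<open>
  The relation \<open>\<partial>\<^sub>i a = a \<partial>\<^sub>i + (\<partial>\<^sub>i a)\<close> moves a derivative applied last into normal order.
\<close>

lemma mderiv_right_quant:
  "mderiv i (right_quant p f) = right_quant (var (Inl i) * p + mderiv (Inr i) p) f"
proof (induction p arbitrary: f rule: pol_induct)
  case (const c)
  show ?case by (simp add: mderiv_const_mult right_quant_add right_quant_xi_mult)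
next
  case (add p q)
  then show ?case by (simp add: mderiv_add right_quant_add distrib_left)
next
  case (var v p)
  show ?case
  proof (cases v)
    case (Inl j)
    then show ?thesis
      using var[of "mderiv j f"]
      by (simp add: right_quant_add right_quant_xi_mult mderiv_var_mult mderiv_commute)
  next
    case (Inr j)
    then show ?thesis
      using var[of f]
      by (simp add: right_quant_add right_quant_xi_mult right_quant_z_mult mderiv_var_mult
          distrib_left)
  qed
qed

text \<open>
  The relation \<open>\<partial>\<^sup>\<alpha> z\<^sub>i = z\<^sub>i \<partial>\<^sup>\<alpha> + \<alpha>\<^sub>i \<partial>\<^bsup>\<alpha>-e\<^esup>\<close>, with \<open>e\<close> the \<open>i\<close>-th unit exponent, moves a multiplication
  applied first into normal order; the correction is the formal derivative with respect to \<open>\<xi>\<^sub>i\<close>.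
\<close>

lemma right_quant_var_mult:
  "right_quant p (var i * f) = right_quant (var (Inr i) * p + mderiv (Inl i) p) f"
proof (induction p arbitrary: f rule: pol_induct)
  case (const c)
  show ?case by (simp add: right_quant_add right_quant_z_mult mult.left_commute)
next
  case (add p q)
  then show ?case by (simp add: mderiv_add right_quant_add distrib_left)
next
  case (var v p)
  show ?case
  proof (cases v)
    case (Inl j)
    then show ?thesis
      using var[of "mderiv j f"]
      by (auto simp: right_quant_add right_quant_xi_mult right_quant_z_mult mderiv_var_mult
          right_quant_add_right)
  next
    case (Inr j)
    then show ?thesis
      using var[of f]
      by (simp add: right_quant_add right_quant_z_mult mderiv_var_mult
          distrib_left mult.left_commute)
  qed
qed

text \<open>
  Both sides agree on constants, and multiplying \<open>p\<close> by a variable changes the left side by a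
  composition with \<open>\<partial>\<^sub>i\<close> or \<open>z\<^sub>i\<close>, whose effect on the right symbol is exactly the conjugation by \<open>\<Phi>\<close>
  at \<open>t = 1\<close>.
\<close>

lemma left_quant_eq_right_quant_Phi: "left_quant p = right_quant (Phi 1 p)"
proof (rule ext)
  fix f
  show "left_quant p f = right_quant (Phi 1 p) f"
  proof (induction p arbitrary: f rule: pol_induct)
    case (const c)
    show ?case by simp
  next
    case (add p q)
    then show ?case by (simp add: Phi_add left_quant_add right_quant_add)
  next
    case (var v p)
    then show ?case
      by (cases v) (simp_all add: Phi_var_mult left_quant_xi_mult left_quant_z_mult
          mderiv_right_quant right_quant_var_mult mderiv_Phi)
  qed
qed

text \<open>
  Derivatives kill the constant \<open>1\<close>, so that only the part of \<open>p\<close> without \<open>\<xi>\<close> survives.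
\<close>

lemma lookup_right_quant_1:
  assumes "xi_part m = 0"
  shows "Poly_Mapping.lookup (right_quant p 1) (z_part m) = Poly_Mapping.lookup p m"
proof (induction p rule: poly_mapping_add_induct)
  case (single m' c)
  show ?case
  proof (cases "xi_part m' = 0")
    case True
    have "m' = m" if "z_part m' = z_part m"
    proof (rule poly_mapping_eqI)
      fix v show "Poly_Mapping.lookup m' v = Poly_Mapping.lookup m v"
        using True assms that lookup_xi_part[of m'] lookup_xi_part[of m]
          lookup_z_part[of m'] lookup_z_part[of m]
        by (cases v) simp_all
    qed
    then show ?thesis
      using True by (auto simp: right_quant_single lookup_single when_def)
  next
    case False
    then have "m' \<noteq> m" using assms by auto
    then show ?thesis
      using False by (simp add: right_quant_single mderiv_pow_1 lookup_single)
  qed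
qed (simp add: right_quant_add lookup_add)

text \<open>
  If the operator of \<open>p\<close> vanishes, then so does its commutator with \<open>z\<^sub>i\<close>, which is the operator of
  \<open>\<delta>\<^sub>i p\<close>. Each coefficient of \<open>p\<close> at a monomial containing \<open>\<xi>\<^sub>i\<close> is, up to a nonzero factor, a
  coefficient of \<open>\<delta>\<^sub>i p\<close> at a monomial of lower degree in \<open>\<xi>\<close>; those without \<open>\<xi>\<close> are seen by applying
  the operator to \<open>1\<close>.
\<close>

lemma right_quant_eq_0_imp:
  assumes "right_quant p = (\<lambda>f. 0)"
  shows "p = 0"
proof -
  have "Poly_Mapping.lookup p m = 0" for m
    using assms
  proof (induction "xi_degree m" arbitrary: m p)
    case 0
    then have "xi_part m = 0"
      by (intro poly_mapping_eqI) (simp add: xi_degree_def)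
    then show ?case
      using lookup_right_quant_1[of m p] 0 by simp
  next
    case (Suc d)
    then obtain i where i: "Poly_Mapping.lookup m (Inl i) \<noteq> 0"
      unfolding xi_degree_def by (metis (no_types, lifting) sum.neutral nat.distinct(1))
    let ?e = "Poly_Mapping.single (Inl i) (1::nat)"
    have m: "m - ?e + ?e = m"
      using i by (intro poly_mapping_eqI) (auto simp: lookup_add lookup_minus lookup_single when_def)
    have "xi_degree (m - ?e + ?e) = Suc (xi_degree (m - ?e))"
      by (simp add: xi_degree_def lookup_add lookup_single when_def sum.distrib)
    then have d: "d = xi_degree (m - ?e)"
      using Suc(2) m by simp
    have "right_quant (mderiv (Inl i) p) f = 0" for f
      using right_quant_var_mult[of p i f] Suc(3) by (simp add: right_quant_add right_quant_z_mult)
    then have "Poly_Mapping.lookup (mderiv (Inl i) p) (m - ?e) = 0"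
      using Suc(1)[OF d] by blast
    moreover have "of_nat (k + 1) \<noteq> (0::complex)" for k
      by (simp only: of_nat_eq_0_iff)
    ultimately show ?case
      unfolding lookup_mderiv m by (simp only: mult_eq_0_iff) blast
  qed
  then show ?thesis by (simp add: poly_mapping_eqI)
qed

lemma inj_right_quant: "inj right_quant"
proof (rule injI)
  fix p q :: "('a + 'a) pol"
  assume *: "right_quant p = right_quant q"
  have "right_quant (p - q) f + right_quant q f = right_quant p f" for f
    by (simp flip: right_quant_add)
  with * have "right_quant (p - q) = (\<lambda>f. 0)"
    by (simp add: fun_eq_iff)
  then show "p = q" using right_quant_eq_0_imp by force
qed

lemma inj_left_quant: "inj left_quant"
proof (rule injI)
  fix p q :: "('a + 'a) pol"
  assume "left_quant p = left_quant q"
  then have "Phi 1 p = Phi 1 q"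
    unfolding left_quant_eq_right_quant_Phi by (rule injD[OF inj_right_quant])
  then show "p = q" by (metis Phi_uminus_Phi)
qed

lemma right_quant_in_weyl: "right_quant p \<in> weyl_algebra"
proof (induction p rule: pol_induct)
  case (const c)
  show ?case using weyl_algebra.mult[of "const c"] by (simp add: fun_eq_iff)
next
  case (add p q)
  have "right_quant (p + q) = (\<lambda>f. right_quant p f + right_quant q f)"
    by (simp add: fun_eq_iff right_quant_add)
  then show ?case using weyl_algebra.add[OF add] by simp
next
  case (var v p)
  show ?case
  proof (cases v)
    case (Inl i)
    have "right_quant (var v * p) = right_quant p \<circ> mderiv i"
      by (simp add: fun_eq_iff right_quant_xi_mult Inl)
    then show ?thesis using weyl_algebra.comp[OF var weyl_algebra.deriv] by metis
  next
    case (Inr i)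
    have "right_quant (var v * p) = (\<lambda>f. var i * f) \<circ> right_quant p"
      by (simp add: fun_eq_iff right_quant_z_mult Inr)
    then show ?thesis using weyl_algebra.comp[OF weyl_algebra.mult var] by metis
  qed
qed

text \<open>
  Normally ordered operators are closed under composition: the factors of the left operator are
  absorbed one at a time, and \<open>mderiv_right_quant\<close> reorders each derivative.
\<close>

lemma right_quant_comp: "\<exists>r. right_quant p \<circ> right_quant q = right_quant r"
proof (induction p arbitrary: q rule: pol_induct)
  case (const c)
  have "const c * right_quant q f = right_quant (const c * q) f" for f
    by (induction q rule: poly_mapping_add_induct)
       (simp_all add: right_quant_single mult_single right_quant_add distrib_left flip: mult.assoc)
  then show ?case by (auto simp: fun_eq_iff)
next
  case (add p p')
  obtain r r' where "right_quant p \<circ> right_quant q = right_quant r"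
    "right_quant p' \<circ> right_quant q = right_quant r'"
    using add by meson
  then have "right_quant (p + p') \<circ> right_quant q = right_quant (r + r')"
    by (simp add: fun_eq_iff right_quant_add)
  then show ?case ..
next
  case (var v p)
  show ?case
  proof (cases v)
    case (Inl i)
    then have "right_quant (var v * p) \<circ> right_quant q
        = right_quant p \<circ> right_quant (var (Inl i) * q + mderiv (Inr i) q)"
      by (simp add: fun_eq_iff right_quant_xi_mult mderiv_right_quant)
    then show ?thesis using var by simp
  next
    case (Inr i)
    obtain r where "right_quant p \<circ> right_quant q = right_quant r"
      using var by blast
    then have "right_quant (var v * p) \<circ> right_quant q = right_quant (var (Inr i) * r)"
      by (simp add: fun_eq_iff right_quant_z_mult Inr)
    then show ?thesis ..
  qed
qed

lemma weyl_algebra_eq_range_right_quant: "weyl_algebra = range right_quant"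
proof
  show "range right_quant \<subseteq> weyl_algebra"
    using right_quant_in_weyl by blast
  show "weyl_algebra \<subseteq> (range right_quant :: (('n::finite) pol \<Rightarrow> 'n pol) set)"
  proof
    fix \<phi> :: "'n pol \<Rightarrow> 'n pol"
    assume "\<phi> \<in> weyl_algebra"
    then show "\<phi> \<in> range right_quant"
    proof induction
      case (mult a)
      show ?case
      proof (induction a rule: pol_induct)
        case (const c)
        have "(\<lambda>f. const c * f) = right_quant (const c)" by (simp add: fun_eq_iff)
        then show ?case by blast
      next
        case (add a b)
        then obtain p q where "(\<lambda>f. a * f) = right_quant p" "(\<lambda>f. b * f) = right_quant q"
          by blast
        then have "(\<lambda>f. (a + b) * f) = right_quant (p + q)"
          by (simp add: fun_eq_iff right_quant_add distrib_right)
        then show ?case by blast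
      next
        case (var i a)
        then obtain p where "(\<lambda>f. a * f) = right_quant p" by blast
        then have "(\<lambda>f. var i * a * f) = right_quant (var (Inr i) * p)"
          by (simp add: fun_eq_iff right_quant_z_mult mult.assoc)
        then show ?case by blast
      qed
    next
      case (deriv i)
      have "mderiv i = right_quant (var (Inl i) * const 1)"
        by (rule ext) (subst right_quant_xi_mult, subst right_quant_const, simp)
      then show ?case by blast
    next
      case (add \<phi> \<psi>)
      then obtain p q where "\<phi> = right_quant p" "\<psi> = right_quant q" by blast
      then have "(\<lambda>f. \<phi> f + \<psi> f) = right_quant (p + q)"
        by (simp add: fun_eq_iff right_quant_add)
      then show ?case by blast
    next
      case (comp \<phi> \<psi>)
      then show ?case using right_quant_comp by blast
    qed
  qed
qed

lemma weyl_algebra_eq_range_left_quant: "weyl_algebra = range left_quant"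
proof -
  have "right_quant p = left_quant (Phi (-1) p)" for p :: "(('n::finite) + 'n) pol"
    using Phi_uminus_Phi[of "-1" p] by (simp add: left_quant_eq_right_quant_Phi)
  then show ?thesis
    unfolding weyl_algebra_eq_range_right_quant
    by (auto simp: left_quant_eq_right_quant_Phi)
qed

section \<open>The total symbols\<close>

lemma lookup_rename_expo:
  assumes "inj h"
  shows "Poly_Mapping.lookup (rename_expo h m) (h v) = Poly_Mapping.lookup m v"
proof -
  have "Poly_Mapping.lookup (rename_expo h m) (h v)
      = (\<Sum>u\<in>Poly_Mapping.keys m. if u = v then Poly_Mapping.lookup m u else 0)"
    unfolding rename_expo_def lookup_sum lookup_single when_def
    using assms by (intro sum.cong) (auto dest: injD)
  then show ?thesis by (simp add: in_keys_iff)
qed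

lemma lookup_rename_expo_notin_range:
  "w \<notin> range h \<Longrightarrow> Poly_Mapping.lookup (rename_expo h m) w = 0"
  unfolding rename_expo_def lookup_sum lookup_single when_def by (intro sum.neutral) auto

lemma lookup_rename_expo_Inl_Inr [simp]:
  "Poly_Mapping.lookup (rename_expo Inl \<alpha>) (Inl i) = Poly_Mapping.lookup \<alpha> i"
  "Poly_Mapping.lookup (rename_expo Inl \<alpha>) (Inr i) = 0"
  "Poly_Mapping.lookup (rename_expo Inr \<alpha>) (Inr i) = Poly_Mapping.lookup \<alpha> i"
  "Poly_Mapping.lookup (rename_expo Inr \<alpha>) (Inl i) = 0"
  by (auto simp: lookup_rename_expo intro: lookup_rename_expo_notin_range)

lemma rename_pol_single:
  "rename_pol h (Poly_Mapping.single m c) = Poly_Mapping.single (rename_expo h m) c"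
  unfolding rename_pol_def by (rule sum_keys_single) simp

lemma rename_pol_add: "rename_pol h (p + q) = rename_pol h p + rename_pol h q"
  unfolding rename_pol_def by (rule setsum_keys_plus_distrib) (simp_all add: single_add)

lemma rename_pol_0 [simp]: "rename_pol h 0 = 0"
  by (simp add: rename_pol_def)

lemma symbol_pol_add: "symbol_pol (a + b) = symbol_pol a + symbol_pol b"
  unfolding symbol_pol_def
  by (rule setsum_keys_plus_distrib) (simp_all add: rename_pol_add distrib_right)

lemma right_op_add: "right_op (a + b) f = right_op a f + right_op b f"
  unfolding right_op_def
  by (rule setsum_keys_plus_distrib) (simp_all add: distrib_right)

lemma left_op_add: "left_op (a + b) f = left_op a f + left_op b f"
  unfolding left_op_def
  by (rule setsum_keys_plus_distrib) (simp_all add: distrib_right mderiv_pow_add)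

lemma symbol_pol_single_single:
  "symbol_pol (Poly_Mapping.single \<alpha> (Poly_Mapping.single \<beta> c)) =
     Poly_Mapping.single (rename_expo Inr \<beta> + rename_expo Inl \<alpha>) c"
  unfolding symbol_pol_def
  by (subst sum_keys_single) (simp_all add: rename_pol_single mult_single)

lemma right_op_single: "right_op (Poly_Mapping.single \<alpha> a) f = a * mderiv_pow \<alpha> f"
  unfolding right_op_def by (rule sum_keys_single) simp

lemma left_op_single: "left_op (Poly_Mapping.single \<alpha> a) f = mderiv_pow \<alpha> (a * f)"
  unfolding left_op_def by (rule sum_keys_single) simp

lemma pol_family_induct [case_names single add]:
  fixes a :: "'k \<Rightarrow>\<^sub>0 ('l \<Rightarrow>\<^sub>0 'b::comm_monoid_add)"
  assumes single: "\<And>\<alpha> \<beta> c. P (Poly_Mapping.single \<alpha> (Poly_Mapping.single \<beta> c))"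
    and add: "\<And>a b. P a \<Longrightarrow> P b \<Longrightarrow> P (a + b)"
  shows "P a"
proof (induction a rule: poly_mapping_add_induct)
  case (single \<alpha> g)
  show ?case
    by (induction g rule: poly_mapping_add_induct) (auto simp: single_add intro: assms)
qed (rule add)

lemma parts_rename_expo:
  "xi_part (rename_expo Inr \<beta> + rename_expo Inl \<alpha>) = \<alpha>"
  "z_part (rename_expo Inr \<beta> + rename_expo Inl \<alpha>) = \<beta>"
  by (auto intro!: poly_mapping_eqI simp: lookup_add)

lemma rename_expo_parts: "rename_expo Inr (z_part m) + rename_expo Inl (xi_part m) = m"
proof (rule poly_mapping_eqI)
  fix v show "Poly_Mapping.lookup (rename_expo Inr (z_part m) + rename_expo Inl (xi_part m)) v
    = Poly_Mapping.lookup m v"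
    by (cases v) (auto simp: lookup_add)
qed

text \<open>
  \<open>symbol_pol\<close> merely regroups coefficients: splitting an exponent into its \<open>\<xi>\<close>-part and its \<open>z\<close>-part is
  a bijection.
\<close>

lemma lookup_symbol_pol:
  "Poly_Mapping.lookup (symbol_pol a) m = Poly_Mapping.lookup (Poly_Mapping.lookup a (xi_part m)) (z_part m)"
proof (induction a rule: pol_family_induct)
  case (single \<alpha> \<beta> c)
  have "rename_expo Inr \<beta> + rename_expo Inl \<alpha> = m \<longleftrightarrow> \<alpha> = xi_part m \<and> \<beta> = z_part m"
    using parts_rename_expo rename_expo_parts by metis
  then show ?case
    by (auto simp: symbol_pol_single_single lookup_single when_def)
qed (simp add: symbol_pol_add lookup_add)

lemma bij_symbol_pol: "bij (symbol_pol :: (('n::finite) expo \<Rightarrow>\<^sub>0 'n pol) \<Rightarrow> ('n + 'n) pol)"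
proof (rule bijI)
  show "inj (symbol_pol :: ('n expo \<Rightarrow>\<^sub>0 'n pol) \<Rightarrow> ('n + 'n) pol)"
    by (intro injI poly_mapping_eqI) (metis lookup_symbol_pol parts_rename_expo)
  have "p \<in> range symbol_pol" for p :: "('n + 'n) pol"
  proof (induction p rule: poly_mapping_add_induct)
    case (single m c)
    have "symbol_pol (Poly_Mapping.single (xi_part m) (Poly_Mapping.single (z_part m) c))
        = Poly_Mapping.single m c"
      by (simp add: symbol_pol_single_single rename_expo_parts)
    then show ?case by (metis rangeI)
  next
    case (add p q)
    then obtain a b where "p = symbol_pol a" "q = symbol_pol b" by blast
    then have "p + q = symbol_pol (a + b)" by (simp add: symbol_pol_add)
    then show ?case by blast
  qed
  then show "surj (symbol_pol :: ('n expo \<Rightarrow>\<^sub>0 'n pol) \<Rightarrow> ('n + 'n) pol)" by blast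
qed

lemma right_op_eq_right_quant: "right_op a = right_quant (symbol_pol a)"
proof (rule ext)
  fix f show "right_op a f = right_quant (symbol_pol a) f"
    by (induction a rule: pol_family_induct)
       (simp_all add: right_op_single symbol_pol_single_single right_quant_single parts_rename_expo
          right_op_add symbol_pol_add right_quant_add)
qed

lemma left_op_eq_left_quant: "left_op a = left_quant (symbol_pol a)"
proof (rule ext)
  fix f show "left_op a f = left_quant (symbol_pol a) f"
    by (induction a rule: pol_family_induct)
       (simp_all add: left_op_single symbol_pol_single_single left_quant_single parts_rename_expo
          left_op_add symbol_pol_add left_quant_add)
qed

text \<open>
  Uniqueness of the coefficient family, which makes the definite description meaningful, is the
  injectivity of \<open>right_quant\<close> combined with that of \<open>symbol_pol\<close>.
\<close>

lemma right_symbol_right_quant: "right_symbol (right_quant p) = p"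
proof -
  obtain a where p: "p = symbol_pol a"
    using bij_symbol_pol by (meson bij_pointE)
  have "(THE b. right_quant p = right_op b) = a"
    unfolding right_op_eq_right_quant p
    using injD[OF inj_right_quant] injD[OF bij_is_inj[OF bij_symbol_pol]] by blast
  then show ?thesis by (simp add: right_symbol_def p)
qed

lemma left_symbol_left_quant: "left_symbol (left_quant p) = p"
proof -
  obtain a where p: "p = symbol_pol a"
    using bij_symbol_pol by (meson bij_pointE)
  have "(THE b. left_quant p = left_op b) = a"
    unfolding left_op_eq_left_quant p
    using injD[OF inj_left_quant] injD[OF bij_is_inj[OF bij_symbol_pol]] by blast
  then show ?thesis by (simp add: left_symbol_def p)
qed

lemma inv_into_right_symbol: "inv_into weyl_algebra right_symbol p = right_quant p"
  by (rule inv_into_f_eq)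
     (auto intro!: inj_onI simp: weyl_algebra_eq_range_right_quant right_symbol_right_quant)

lemma inv_into_left_symbol: "inv_into weyl_algebra left_symbol p = left_quant p"
  by (rule inv_into_f_eq)
     (auto intro!: inj_onI simp: weyl_algebra_eq_range_left_quant left_symbol_left_quant)

theorem theorem3p1:
  shows "(Phi 1 :: (('n::finite) + 'n) pol \<Rightarrow> ('n + 'n) pol)
           = right_symbol \<circ> inv_into weyl_algebra left_symbol
       \<and> (Phi (-1) :: ('n + 'n) pol \<Rightarrow> ('n + 'n) pol)
           = left_symbol \<circ> inv_into weyl_algebra right_symbol"
proof (intro conjI ext)
  fix p :: "('n + 'n) pol"
  show "Phi 1 p = (right_symbol \<circ> inv_into weyl_algebra left_symbol) p"
    by (simp add: inv_into_left_symbol left_quant_eq_right_quant_Phi right_symbol_right_quant)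
  have "Phi 1 (Phi (-1) p) = p"
    using Phi_uminus_Phi[of "-1" p] by simp
  then have "right_quant p = left_quant (Phi (-1) p)"
    by (simp add: left_quant_eq_right_quant_Phi)
  then show "Phi (-1) p = (left_symbol \<circ> inv_into weyl_algebra right_symbol) p"
    by (simp add: inv_into_right_symbol left_symbol_left_quant)
qed

end
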